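(* Let $V$ be a complex Hilbert space, $S$ a densely defined symmetric operator on $V$, and $(H_-,H_+,G_-,G_+)$ a boundary quadruple for $S$. Assume that $H_+$ and $H_-$ are isomorphic (i.e. there exists a unitary operator from $H_+$ onto $H_-$). Let $T$ be an operator on $V$ such that $S\subset T$. The following assertions are equivalent: (i) $T$ is selfadjoint; (ii) there exists a unitary operator $\Phi:H_+\to H_-$ such that $D(T)=\{w\in D(S^* ):\Phi G_+w=G_-w\}$ and $Tw=S^*w$ for all $w\in D(T)$.
   Context: Inner products are linear in the first argument. An operator $T$ on $V$ is a linear map $T:D(T)\to V$ defined on a linear subspace $D(T)\subset V$; $S\subset T$ means $D(S)\subset D(T)$ and $Tx=Sx$ for $x\in D(S)$. $S$ is symmetric if $\langle Su,v\rangle_V=\langle u,Sv\rangle_V$ for all $u,v\in D(S)$. $T$ is selfadjoint if $D(T)$ is dense and $T=T^*$. A boundary quadruple $(H_-,H_+,G_-,G_+)$ for $S$ consists of complex pre-Hilbert spaces $H_-,H_+$ and surjective linear maps $G_-:D(S^* )\to H_-$, $G_+:D(S^* )\to H_+$ such that $\langle S^*u,v\rangle_V-\langle u,S^*v\rangle_V=i\left(\langle G_-u,G_-v\rangle_{H_-}-\langle G_+u,G_+v\rangle_{H_+}\right)$ for all $u,v\in D(S^* )$, and $\ker G_++\ker G_-=D(S^* )$. A unitary operator is a surjective linear isometry. *)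

theory Defs
  imports "HOL-Analysis.Analysis"
begin

class scaleC =
  fixes scaleC :: "complex \<Rightarrow> 'a \<Rightarrow> 'a"  (infixr \<open>*\<^sub>C\<close> 75)

class complex_vector = real_vector + scaleC +
  assumes scaleC_add_right: "a *\<^sub>C (x + y) = a *\<^sub>C x + a *\<^sub>C y"
    and scaleC_add_left: "(a + b) *\<^sub>C x = a *\<^sub>C x + b *\<^sub>C x"
    and scaleC_scaleC: "a *\<^sub>C (b *\<^sub>C x) = (a * b) *\<^sub>C x"
    and scaleC_one: "1 *\<^sub>C x = x"
    and scaleR_scaleC: "r *\<^sub>R x = complex_of_real r *\<^sub>C x"

text \<open>Complex pre-Hilbert spaces; the inner product is linear in the first argument.
  Building on \<open>real_normed_vector\<close> fixes the topology induced by the norm; the norm axioms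
  themselves are consequences of the inner product axioms.\<close>

class complex_inner = complex_vector + real_normed_vector +
  fixes cinner :: "'a \<Rightarrow> 'a \<Rightarrow> complex"
  assumes cinner_commute: "cinner x y = cnj (cinner y x)"
    and cinner_add_left: "cinner (x + y) z = cinner x z + cinner y z"
    and cinner_scaleC_left: "cinner (a *\<^sub>C x) y = a * cinner x y"
    and cinner_ge_zero: "0 \<le> Re (cinner x x)"
    and cinner_eq_zero_iff: "cinner x x = 0 \<longleftrightarrow> x = 0"
    and norm_eq_sqrt_cinner: "norm x = sqrt (Re (cinner x x))"

class chilbert_space = complex_inner + complete_space

instantiation complex :: chilbert_space
begin

definition scaleC_complex :: "complex \<Rightarrow> complex \<Rightarrow> complex"
  where "scaleC_complex a x = a * x"

definition cinner_complex :: "complex \<Rightarrow> complex \<Rightarrow> complex"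
  where "cinner_complex x y = x * cnj y"

instance
  by standard
    (auto simp: scaleC_complex_def cinner_complex_def algebra_simps scaleR_conv_of_real
      cmod_def power2_eq_square)

end

global_interpretation complex_vector:
  vector_space "scaleC :: complex \<Rightarrow> 'a \<Rightarrow> 'a::complex_vector"
  defines csubspace = complex_vector.subspace
  by standard (simp_all add: scaleC_add_right scaleC_add_left scaleC_scaleC scaleC_one)

abbreviation clinear :: "('a::complex_vector \<Rightarrow> 'b::complex_vector) \<Rightarrow> bool"
  where "clinear \<equiv> Vector_Spaces.linear scaleC scaleC"

definition unitary :: "('a::complex_inner \<Rightarrow> 'b::complex_inner) \<Rightarrow> bool"
  where "unitary U \<longleftrightarrow> clinear U \<and> surj U \<and> (\<forall>x. norm (U x) = norm x)"

text \<open>A linear map defined on a subspace is a partial function \<open>T\<close> with domain \<open>dom T\<close>;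
  thus the inclusion of operators is \<open>S \<subseteq>\<^sub>m T\<close>, and equality of operators, domains
  included, is \<open>S = T\<close>.\<close>

definition linear_operator :: "('a::complex_vector \<rightharpoonup> 'b::complex_vector) \<Rightarrow> bool"
  where "linear_operator T \<longleftrightarrow> csubspace (dom T) \<and>
    (\<forall>x\<in>dom T. \<forall>y\<in>dom T. the (T (x + y)) = the (T x) + the (T y)) \<and>
    (\<forall>a. \<forall>x\<in>dom T. the (T (a *\<^sub>C x)) = a *\<^sub>C the (T x))"

definition op_ker :: "('a \<rightharpoonup> 'b::zero) \<Rightarrow> 'a set"
  where "op_ker G = {x \<in> dom G. the (G x) = 0}"

definition densely_defined :: "('a::topological_space \<rightharpoonup> 'b) \<Rightarrow> bool"
  where "densely_defined T \<longleftrightarrow> closure (dom T) = UNIV"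

definition symmetric_operator :: "('v::complex_inner \<rightharpoonup> 'v) \<Rightarrow> bool"
  where "symmetric_operator S \<longleftrightarrow>
    (\<forall>u\<in>dom S. \<forall>v\<in>dom S. cinner (the (S u)) v = cinner u (the (S v)))"

text \<open>The vector \<open>w\<close> with \<open>\<langle>T u, v\<rangle> = \<langle>u, w\<rangle>\<close> for all \<open>u \<in> dom T\<close> is unique when \<open>T\<close> is densely
  defined; the adjoint is meaningful only in that case.\<close>

definition op_adjoint :: "('v::complex_inner \<rightharpoonup> 'v) \<Rightarrow> ('v \<rightharpoonup> 'v)"
  where "op_adjoint T v =
    (if \<exists>w. \<forall>u\<in>dom T. cinner (the (T u)) v = cinner u w
     then Some (THE w. \<forall>u\<in>dom T. cinner (the (T u)) v = cinner u w)
     else None)"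

definition selfadjoint_operator :: "('v::complex_inner \<rightharpoonup> 'v) \<Rightarrow> bool"
  where "selfadjoint_operator T \<longleftrightarrow> densely_defined T \<and> T = op_adjoint T"

text \<open>The spaces \<open>H\<^sub>-\<close> and \<open>H\<^sub>+\<close> of a boundary quadruple are the types \<open>'m\<close> and \<open>'p\<close>.\<close>

definition boundary_quadruple ::
    "('v::complex_inner \<rightharpoonup> 'v) \<Rightarrow> ('v \<rightharpoonup> 'm::complex_inner) \<Rightarrow> ('v \<rightharpoonup> 'p::complex_inner) \<Rightarrow> bool"
  where "boundary_quadruple S Gm Gp \<longleftrightarrow>
    linear_operator Gm \<and> dom Gm = dom (op_adjoint S) \<and> ran Gm = UNIV \<and>
    linear_operator Gp \<and> dom Gp = dom (op_adjoint S) \<and> ran Gp = UNIV \<and>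
    (\<forall>u\<in>dom (op_adjoint S). \<forall>v\<in>dom (op_adjoint S).
      cinner (the (op_adjoint S u)) v - cinner u (the (op_adjoint S v)) =
      \<i> * (cinner (the (Gm u)) (the (Gm v)) - cinner (the (Gp u)) (the (Gp v)))) \<and>
    {x + y | x y. x \<in> op_ker Gp \<and> y \<in> op_ker Gm} = dom (op_adjoint S)"

end

theory Submission
  imports Defs
begin

text \<open>
  Green's identity turns both assertions into statements about the relation
  \<open>\<Gamma> = {(G\<^sub>+ w, G\<^sub>- w) | w \<in> D(T)}\<close>, and \<open>(G\<^sub>+, G\<^sub>-)\<close> maps \<open>D(S\<^sup>*)\<close> onto \<open>H\<^sub>+ \<times> H\<^sub>-\<close>. If \<open>\<Gamma>\<close> is
  the graph of a unitary operator, it equals its own orthogonal complement for the indefinite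
  form, so \<open>T = T\<^sup>*\<close>. If \<open>T\<close> is selfadjoint, \<open>\<Gamma>\<close> is the graph of an isometry
  whose domain and range have trivial orthogonal complements. As \<open>H\<^sub>-\<close> and \<open>H\<^sub>+\<close> are only
  pre-Hilbert spaces, it remains to see that domain and range are complete. The Baire category
  theorem, applied to the graph of \<open>S\<^sup>*\<close>, shows that \<open>G\<^sub>-\<close> and \<open>G\<^sub>+\<close> are bounded for the
  graph norm. Every element of \<open>\<Gamma>\<close> comes from some \<open>w \<in> D(T)\<close> such that
  \<open>k = T w - i w\<close> satisfies \<open>S\<^sup>* k = - i k\<close>, and Green's identity for \<open>k\<close> and \<open>w\<close> gives
  \<open>\<parallel>k\<parallel>\<^sup>2 \<le> (\<parallel>G\<^sub>- k\<parallel> + \<parallel>G\<^sub>+ k\<parallel>) \<parallel>G\<^sub>- w\<parallel>\<close>. Hence Cauchy sequences of boundary values lift to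
  Cauchy sequences in \<open>D(T)\<close>.
\<close>

subsection \<open>Geometry of complex inner product spaces\<close>

lemma cinner_add_right: "cinner x (y + z) = cinner x y + cinner x z"
  for x y z :: "'a::complex_inner"
  by (metis cinner_add_left cinner_commute complex_cnj_add)

lemma cinner_scaleC_right: "cinner x (a *\<^sub>C y) = cnj a * cinner x y"
  for x y :: "'a::complex_inner"
  by (metis cinner_commute cinner_scaleC_left complex_cnj_mult)

lemma cinner_zero_left [simp]: "cinner 0 y = 0" for y :: "'a::complex_inner"
  using cinner_add_left [of 0 0 y] by simp

lemma cinner_zero_right [simp]: "cinner x 0 = 0" for x :: "'a::complex_inner"
  using cinner_add_right [of x 0 0] by simp

lemma cinner_diff_left: "cinner (x - y) z = cinner x z - cinner y z"
  for x y z :: "'a::complex_inner"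
  using cinner_add_left [of "x - y" y z] by simp

lemma cinner_diff_right: "cinner x (y - z) = cinner x y - cinner x z"
  for x y z :: "'a::complex_inner"
  using cinner_add_right [of x "y - z" z] by simp

lemma cinner_minus_left: "cinner (- x) y = - cinner x y" for x y :: "'a::complex_inner"
  using cinner_diff_left [of 0 x y] by simp

lemma cinner_minus_right: "cinner x (- y) = - cinner x y" for x y :: "'a::complex_inner"
  using cinner_diff_right [of x 0 y] by simp

lemmas cinner_simps =
  cinner_minus_left cinner_minus_right
  cinner_add_left cinner_add_right cinner_diff_left cinner_diff_right
  cinner_scaleC_left cinner_scaleC_right

lemma cinner_self: "cinner x x = of_real ((norm x)\<^sup>2)" for x :: "'a::complex_inner"
proof -
  have "Im (cinner x x) = 0"
    using arg_cong [OF cinner_commute [of x x], of Im] by simp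
  then show ?thesis
    by (simp add: norm_eq_sqrt_cinner cinner_ge_zero complex_eq_iff)
qed

lemma norm_power2_eq_cinner: "(norm x)\<^sup>2 = Re (cinner x x)" for x :: "'a::complex_inner"
  by (simp add: cinner_self)

lemma norm_scaleC: "norm (a *\<^sub>C x) = cmod a * norm x" for x :: "'a::complex_inner"
proof -
  have "cinner (a *\<^sub>C x) (a *\<^sub>C x) = (a * cnj a) * cinner x x"
    by (simp add: cinner_simps)
  then have "complex_of_real ((norm (a *\<^sub>C x))\<^sup>2) = of_real ((cmod a * norm x)\<^sup>2)"
    by (simp only: cinner_self complex_norm_square [symmetric] power_mult_distrib of_real_mult)
  then show ?thesis
    by (simp only: of_real_eq_iff) (simp add: power2_eq_iff_nonneg)
qed

lemma norm_add_power2: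
  "(norm (x + y))\<^sup>2 = (norm x)\<^sup>2 + (norm y)\<^sup>2 + 2 * Re (cinner x y)"
  for x y :: "'a::complex_inner"
  using arg_cong [OF cinner_commute [of y x], of Re]
  by (simp add: norm_power2_eq_cinner cinner_simps)

lemma norm_diff_power2:
  "(norm (x - y))\<^sup>2 = (norm x)\<^sup>2 + (norm y)\<^sup>2 - 2 * Re (cinner x y)"
  for x y :: "'a::complex_inner"
  using arg_cong [OF cinner_commute [of y x], of Re]
  by (simp add: norm_power2_eq_cinner cinner_simps)

text \<open>The vector subtracted is the orthogonal projection of \<open>x\<close> onto the line
  through \<open>y\<close>. Nonnegativity of the left side is Cauchy-Schwarz.\<close>

lemma norm_diff_projection:
  fixes x y :: "'a::complex_inner"
  assumes "y \<noteq> 0"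
  shows "(norm (x - (cinner x y / of_real ((norm y)\<^sup>2)) *\<^sub>C y))\<^sup>2
    = (norm x)\<^sup>2 - (cmod (cinner x y))\<^sup>2 / (norm y)\<^sup>2"
proof -
  have "cinner x y * cnj (cinner x y) = of_real ((cmod (cinner x y))\<^sup>2)"
    by (simp add: complex_norm_square [symmetric])
  then have "Re (cnj (cinner x y / of_real ((norm y)\<^sup>2)) * cinner x y)
      = (cmod (cinner x y))\<^sup>2 / (norm y)\<^sup>2"
    by (metis (no_types, lifting) Re_complex_of_real complex_cnj_complex_of_real
        complex_cnj_divide mult.commute of_real_divide times_divide_eq_right)
  moreover have "cmod (cinner x y / of_real ((norm y)\<^sup>2)) * norm y = cmod (cinner x y) / norm y"
    using assms by (simp add: norm_divide norm_mult power2_eq_square)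
  ultimately show ?thesis
    by (simp only: norm_diff_power2 norm_scaleC cinner_scaleC_right power_divide)
qed

lemma cinner_norm_le: "cmod (cinner x y) \<le> norm x * norm y" for x y :: "'a::complex_inner"
proof (cases "y = 0")
  case False
  have "0 \<le> (norm x)\<^sup>2 - (cmod (cinner x y))\<^sup>2 / (norm y)\<^sup>2"
    by (metis norm_diff_projection [OF False] zero_le_power2)
  then have "(cmod (cinner x y))\<^sup>2 \<le> (norm x * norm y)\<^sup>2"
    using False by (simp add: field_simps power_mult_distrib)
  then show ?thesis
    by (rule power2_le_imp_le) simp
qed simp

section \<open>Continuity of the inner product and of complex scaling\<close>

lemma bounded_bilinear_cinner: "bounded_bilinear (cinner :: 'a::complex_inner \<Rightarrow> 'a \<Rightarrow> complex)"
proof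
  show "\<exists>K. \<forall>a b. norm (cinner a b :: complex) \<le> norm a * norm b * K" for a b :: 'a
    by (rule exI [of _ 1]) (simp add: cinner_norm_le)
qed (simp_all add: cinner_simps scaleR_scaleC scaleC_complex_def)

lemmas tendsto_cinner [tendsto_intros] = bounded_bilinear.tendsto [OF bounded_bilinear_cinner]
lemmas continuous_on_cinner [continuous_intros] =
  bounded_bilinear.continuous_on [OF bounded_bilinear_cinner]

lemma tendsto_scaleC [tendsto_intros]:
  fixes f :: "'b \<Rightarrow> 'a::complex_inner"
  assumes "(f \<longlongrightarrow> l) F"
  shows "((\<lambda>x. a *\<^sub>C f x) \<longlongrightarrow> a *\<^sub>C l) F"
proof (rule bounded_linear.tendsto [OF _ assms])
  show "bounded_linear ((*\<^sub>C) a :: 'a \<Rightarrow> 'a)"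
    by (rule bounded_linear_intro [where K = "cmod a"])
      (simp_all add: scaleC_add_right norm_scaleC scaleR_scaleC scaleC_scaleC mult.commute)
qed

text \<open>Completeness is asked of \<open>M\<close> only, so that the lemma applies inside the
  pre-Hilbert boundary spaces. A minimizing sequence for the distance is Cauchy by the parallelogram
  law, and its limit is the projection.\<close>

lemma orthogonal_projection_exists:
  fixes M :: "'a::complex_inner set"
  assumes M: "csubspace M" and "complete M"
  obtains m where "m \<in> M" "\<And>z. z \<in> M \<Longrightarrow> cinner (x - m) z = 0"
proof -
  define d where "d = infdist x M"
  have ne: "M \<noteq> {}"
    using complex_vector.subspace_0 [OF M] by blast
  have d_le: "d \<le> norm (x - m)" if "m \<in> M" for m
    unfolding d_def dist_norm [symmetric] by (rule infdist_le [OF that])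
  have d_nonneg: "0 \<le> d"
    by (simp add: d_def infdist_nonneg)
  have "\<exists>m\<in>M. (norm (x - m))\<^sup>2 < d\<^sup>2 + inverse (real (Suc n))" for n
  proof -
    have "d < sqrt (d\<^sup>2 + inverse (real (Suc n)))"
      by (rule real_less_rsqrt) simp
    then obtain m where "m \<in> M" "dist x m < sqrt (d\<^sup>2 + inverse (real (Suc n)))"
      unfolding d_def infdist_notempty [OF ne] using ne by (auto simp: cINF_less_iff)
    then show ?thesis
      by (metis dist_norm norm_ge_zero real_sqrt_abs real_sqrt_less_iff abs_of_nonneg)
  qed
  then obtain m where mM: "\<And>n. m n \<in> M"
    and m: "\<And>n. (norm (x - m n))\<^sup>2 < d\<^sup>2 + inverse (real (Suc n))"
    by metis
  \<comment> \<open>Parallelogram law for \<open>x - m j\<close> and \<open>x - m k\<close>; their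
    midpoint has norm at least \<open>d\<close> because the midpoint of \<open>m j\<close> and
    \<open>m k\<close> lies in \<open>M\<close>.\<close>
  have near: "(norm (m j - m k))\<^sup>2 < 2 * inverse (real (Suc j)) + 2 * inverse (real (Suc k))" for j k
  proof -
    have "(1/2) *\<^sub>R (m j + m k) \<in> M"
      using M mM by (simp add: scaleR_scaleC complex_vector.subspace_add complex_vector.subspace_scale)
    from d_le [OF this] have "(2 * d)\<^sup>2 \<le> (norm ((2::real) *\<^sub>R (x - (1/2) *\<^sub>R (m j + m k))))\<^sup>2"
      using d_nonneg by (intro power_mono) auto
    also have "(2::real) *\<^sub>R (x - (1/2) *\<^sub>R (m j + m k)) = (x - m j) + (x - m k)"
      by (simp add: algebra_simps scaleR_2)
    finally have "4 * d\<^sup>2 \<le> (norm ((x - m j) + (x - m k)))\<^sup>2"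
      by (simp add: power_mult_distrib)
    moreover have "m j - m k = (x - m k) - (x - m j)"
      by simp
    ultimately show ?thesis
      using m [of j] m [of k] norm_add_power2 [of "x - m k" "x - m j"]
        norm_diff_power2 [of "x - m k" "x - m j"] by (simp add: add.commute)
  qed
  have "Cauchy m"
  proof (rule CauchyI)
    fix e :: real assume "0 < e"
    then obtain N where N: "inverse (real (Suc N)) < e\<^sup>2 / 4"
      using reals_Archimedean [of "e\<^sup>2 / 4"] by auto
    have "norm (m j - m k) < e" if "N \<le> j" "N \<le> k" for j k
    proof -
      have "inverse (real (Suc j)) \<le> inverse (real (Suc N))" "inverse (real (Suc k)) \<le> inverse (real (Suc N))"
        using that by (simp_all add: le_imp_inverse_le)
      with near [of j k] N have "(norm (m j - m k))\<^sup>2 < e\<^sup>2"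
        by linarith
      then show ?thesis
        using \<open>0 < e\<close> power2_less_imp_less by (meson less_imp_le)
    qed
    then show "\<exists>N. \<forall>j\<ge>N. \<forall>k\<ge>N. norm (m j - m k) < e"
      by blast
  qed
  with \<open>complete M\<close> mM obtain p where p: "p \<in> M" "m \<longlonglongrightarrow> p"
    by (metis complete_def)
  have "(norm (x - p))\<^sup>2 \<le> d\<^sup>2 + 0"
  proof (rule LIMSEQ_le)
    show "(\<lambda>n. (norm (x - m n))\<^sup>2) \<longlonglongrightarrow> (norm (x - p))\<^sup>2"
      by (intro tendsto_intros p)
    show "(\<lambda>n. d\<^sup>2 + inverse (real (Suc n))) \<longlonglongrightarrow> d\<^sup>2 + 0"
      by (intro tendsto_intros LIMSEQ_inverse_real_of_nat)
    show "\<exists>N. \<forall>n\<ge>N. (norm (x - m n))\<^sup>2 \<le> d\<^sup>2 + inverse (real (Suc n))"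
      using m less_imp_le by blast
  qed
  have "cinner (x - p) z = 0" if "z \<in> M" for z
  proof (cases "z = 0")
    case False
    \<comment> \<open>Moving \<open>p\<close> by the projection of \<open>x - p\<close> onto the
      line through \<open>z\<close> would reduce the distance below \<open>d\<close> unless the
      inner product vanishes.\<close>
    let ?a = "cinner (x - p) z / of_real ((norm z)\<^sup>2)"
    have "p + ?a *\<^sub>C z \<in> M"
      using M p that by (simp add: complex_vector.subspace_add complex_vector.subspace_scale)
    then have "d\<^sup>2 \<le> (norm (x - (p + ?a *\<^sub>C z)))\<^sup>2"
      using d_le d_nonneg by (intro power_mono) auto
    also have "x - (p + ?a *\<^sub>C z) = (x - p) - ?a *\<^sub>C z"
      by simp
    finally have "(cmod (cinner (x - p) z))\<^sup>2 / (norm z)\<^sup>2 \<le> 0"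
      using \<open>(norm (x - p))\<^sup>2 \<le> d\<^sup>2 + 0\<close> unfolding norm_diff_projection [OF False] by simp
    then show ?thesis
      using False by (simp add: divide_le_0_iff)
  qed simp
  then show ?thesis
    using that p by blast
qed

subsection \<open>Linear maps on subspaces\<close>

text \<open>Total functions with an explicit domain let \<open>S^*\<close>, \<open>Gm\<close> and
  \<open>Gp\<close> share one domain without handling options.\<close>

definition clinear_on :: "'a::complex_vector set \<Rightarrow> ('a \<Rightarrow> 'b::complex_vector) \<Rightarrow> bool"
  where "clinear_on D f \<longleftrightarrow> csubspace D \<and>
    (\<forall>x\<in>D. \<forall>y\<in>D. f (x + y) = f x + f y) \<and> (\<forall>a. \<forall>x\<in>D. f (a *\<^sub>C x) = a *\<^sub>C f x)"

lemma linear_operator_iff_clinear_on: "linear_operator T \<longleftrightarrow> clinear_on (dom T) (\<lambda>x. the (T x))"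
  by (simp add: linear_operator_def clinear_on_def)

context
  fixes D :: "'a::complex_vector set" and f :: "'a \<Rightarrow> 'b::complex_vector"
  assumes f: "clinear_on D f"
begin

lemma clinear_on_subspace: "csubspace D"
  using f by (simp add: clinear_on_def)

lemma clinear_on_add: "x \<in> D \<Longrightarrow> y \<in> D \<Longrightarrow> f (x + y) = f x + f y"
  using f by (simp add: clinear_on_def)

lemma clinear_on_scaleC: "x \<in> D \<Longrightarrow> f (a *\<^sub>C x) = a *\<^sub>C f x"
  using f by (simp add: clinear_on_def)

lemma clinear_on_diff: "x \<in> D \<Longrightarrow> y \<in> D \<Longrightarrow> f (x - y) = f x - f y"
  using clinear_on_add [of "x - y" y] clinear_on_subspace
  by (simp add: complex_vector.subspace_diff)

lemma clinear_on_zero: "f 0 = 0"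
  using clinear_on_diff [of 0 0] clinear_on_subspace by (simp add: complex_vector.subspace_0)

lemma clinear_on_scaleR: "x \<in> D \<Longrightarrow> f (r *\<^sub>R x) = r *\<^sub>R f x"
  by (simp add: scaleR_scaleC clinear_on_scaleC)

lemma clinear_on_subset: "csubspace E \<Longrightarrow> E \<subseteq> D \<Longrightarrow> clinear_on E f"
  using f by (simp add: clinear_on_def subset_iff)

lemma csubspace_image: "csubspace (f ` D)"
  unfolding complex_vector.subspace_def
proof safe
  show "0 \<in> f ` D"
    using clinear_on_zero complex_vector.subspace_0 [OF clinear_on_subspace] by (metis image_eqI)
  show "f x + f y \<in> f ` D" if "x \<in> D" "y \<in> D" for x y
    using that clinear_on_add complex_vector.subspace_add [OF clinear_on_subspace] by (metis image_eqI)
  show "a *\<^sub>C f x \<in> f ` D" if "x \<in> D" for a x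
    using that clinear_on_scaleC complex_vector.subspace_scale [OF clinear_on_subspace]
    by (metis image_eqI)
qed

end

lemma Cauchy_transfer:
  fixes f :: "nat \<Rightarrow> 'a::real_normed_vector" and g :: "nat \<Rightarrow> 'b::real_normed_vector"
  assumes "Cauchy g" and le: "\<And>m n. norm (f m - f n) \<le> C * norm (g m - g n)"
  shows "Cauchy f"
proof (rule CauchyI)
  fix e :: real assume "0 < e"
  \<comment> \<open>\<open>C\<close> may be zero or negative; the modified constant is
    positive.\<close>
  then have "0 < e / (\<bar>C\<bar> + 1)"
    by simp
  then obtain N where N: "\<And>m n. N \<le> m \<Longrightarrow> N \<le> n \<Longrightarrow> norm (g m - g n) < e / (\<bar>C\<bar> + 1)"
    using CauchyD [OF \<open>Cauchy g\<close>] by blast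
  have "norm (f m - f n) < e" if "N \<le> m" "N \<le> n" for m n
  proof -
    have "norm (f m - f n) \<le> (\<bar>C\<bar> + 1) * norm (g m - g n)"
      using le [of m n] by (rule order_trans) (intro mult_right_mono, auto)
    also have "\<dots> < (\<bar>C\<bar> + 1) * (e / (\<bar>C\<bar> + 1))"
      using N [OF that] by (intro mult_strict_left_mono) auto
    finally show ?thesis
      by simp
  qed
  then show "\<exists>N. \<forall>m\<ge>N. \<forall>n\<ge>N. norm (f m - f n) < e"
    by blast
qed

text \<open>Uniform boundedness on the graph of \<open>A\<close>, which is completely metrizable as
  a closed set. By \<open>weak\<close>, each functional \<open>cinner (g v) y\<close> is continuous
  for the graph norm; Baire's theorem then yields a bound on \<open>g\<close>, whose codomain may be
  incomplete.\<close>

lemma graph_bounded_of_weakly_continuous: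
  fixes A :: "'v::chilbert_space \<Rightarrow> 'v" and g :: "'v \<Rightarrow> 'h::complex_inner"
  assumes A: "clinear_on D A" and g: "clinear_on D g"
    and closed: "closed ((\<lambda>v. (v, A v)) ` D)"
    and weak: "\<And>y. \<exists>a b. \<forall>v\<in>D. cinner (g v) y = cinner (A v) a + cinner v b"
  shows "\<exists>C. \<forall>v\<in>D. norm (g v) \<le> C * (norm v + norm (A v))"
proof -
  let ?G = "(\<lambda>v. (v, A v)) ` D"
  define F where "F n = {p \<in> ?G. norm (g (fst p)) \<le> real n}" for n
  obtain a b where ab: "\<And>y v. v \<in> D \<Longrightarrow> cinner (g v) y = cinner (A v) (a y) + cinner v (b y)"
    using weak by metis
  \<comment> \<open>The norm of \<open>g v\<close> is tested against all \<open>y\<close>, which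
    exhibits \<open>F n\<close> as an intersection of closed sets; the choice \<open>y = g v\<close>
    gives the converse direction.\<close>
  have F_eq: "F n = ?G \<inter> (\<Inter>y. {p. cmod (cinner (snd p) (a y) + cinner (fst p) (b y)) \<le> real n * norm y})"
    for n
  proof -
    have "norm (g v) \<le> real n \<longleftrightarrow>
        (\<forall>y. cmod (cinner (A v) (a y) + cinner v (b y)) \<le> real n * norm y)" if "v \<in> D" for v
    proof
      assume le: "norm (g v) \<le> real n"
      show "\<forall>y. cmod (cinner (A v) (a y) + cinner v (b y)) \<le> real n * norm y"
      proof
        fix y
        show "cmod (cinner (A v) (a y) + cinner v (b y)) \<le> real n * norm y"
          using cinner_norm_le [of "g v" y] mult_right_mono [OF le norm_ge_zero [of y]]
          by (simp add: ab [OF that])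
      qed
    next
      assume "\<forall>y. cmod (cinner (A v) (a y) + cinner v (b y)) \<le> real n * norm y"
      then have "cmod (cinner (g v) (g v)) \<le> real n * norm (g v)"
        by (simp add: ab [OF that])
      then have "norm (g v) * norm (g v) \<le> real n * norm (g v)"
        unfolding cinner_self norm_of_real by (simp add: power2_eq_square)
      then show "norm (g v) \<le> real n"
        by (cases "g v = 0") auto
    qed
    then show ?thesis
      unfolding F_def by auto
  qed
  have closed_F: "closed (F n)" for n
    unfolding F_eq
    by (intro closed_Int closed closed_INT ballI closed_Collect_le continuous_intros)
  have "0 \<in> D"
    by (rule complex_vector.subspace_0 [OF clinear_on_subspace [OF A]])
  have Union_F: "\<Union> (range F) = ?G"
    unfolding F_def using real_arch_simple by auto
  have "\<exists>n. top_of_set ?G interior_of F n \<noteq> {}"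
  proof (rule ccontr)
    assume "\<nexists>n. top_of_set ?G interior_of F n \<noteq> {}"
    then have "top_of_set ?G interior_of \<Union> (range F) = {}"
    proof (intro Baire_category_alt)
      show "completely_metrizable_space (top_of_set ?G) \<or>
          locally_compact_space (top_of_set ?G) \<and> regular_space (top_of_set ?G)"
        using completely_metrizable_space_closedin [OF completely_metrizable_space_euclidean] closed
        by auto
    next
      fix T assume "T \<in> range F"
      moreover have "F n \<subseteq> ?G" for n
        by (auto simp: F_def)
      ultimately show "closedin (top_of_set ?G) T \<and> top_of_set ?G interior_of T = {}"
        using \<open>\<nexists>n. top_of_set ?G interior_of F n \<noteq> {}\<close> closed_F closed_subset by blast
    qed auto
    then show False
      using \<open>0 \<in> D\<close> unfolding Union_F by (metis empty_iff image_eqI interior_of_topspace topspace_euclidean_subtopology)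
  qed
  then obtain n p where p: "p \<in> top_of_set ?G interior_of F n"
    by blast
  then obtain U where U: "openin (top_of_set ?G) U" "p \<in> U" "U \<subseteq> F n"
    unfolding interior_of_def by blast
  then obtain r where r: "0 < r" "ball p r \<inter> ?G \<subseteq> U"
    unfolding openin_contains_ball by blast
  from U obtain v0 where v0: "v0 \<in> D" "p = (v0, A v0)" "norm (g v0) \<le> real n"
    unfolding F_def by auto
  have "norm (g v) \<le> (4 * real n / r) * (norm v + norm (A v))" if v: "v \<in> D" for v
  proof (cases "v = 0")
    case False
    define s where "s = norm v + norm (A v)"
    have "0 < s"
      using False by (simp add: s_def add_pos_nonneg)
    \<comment> \<open>With this scale the shift by \<open>t *\<^sub>R v\<close> has graph norm
      \<open>r / 2\<close>, so \<open>v0 + t *\<^sub>R v\<close> stays in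
      \<open>F n\<close>.\<close>
    define t where "t = r / (2 * s)"
    have "0 < t"
      using \<open>0 < s\<close> r by (simp add: t_def)
    have tv: "t *\<^sub>R v \<in> D"
      using v by (simp add: scaleR_scaleC complex_vector.subspace_scale [OF clinear_on_subspace [OF A]])
    let ?w = "v0 + t *\<^sub>R v"
    have w: "?w \<in> D"
      using v0 tv by (simp add: complex_vector.subspace_add [OF clinear_on_subspace [OF A]])
    have "dist p (?w, A ?w) = norm (t *\<^sub>R v, t *\<^sub>R A v)"
      using v0 v tv by (simp add: dist_norm norm_minus_commute clinear_on_add [OF A] clinear_on_scaleR [OF A] norm_Pair)
    also have "\<dots> \<le> t * s"
      using norm_Pair_le [of "t *\<^sub>R v" "t *\<^sub>R A v"] \<open>0 < t\<close> by (simp add: s_def distrib_left)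
    also have "\<dots> < r"
      using \<open>0 < s\<close> r by (simp add: t_def)
    finally have "(?w, A ?w) \<in> F n"
      using r U w by auto
    then have "norm (g ?w) \<le> real n"
      by (simp add: F_def)
    then have "norm (g v0 + t *\<^sub>R g v) \<le> real n"
      using v0 v tv by (simp add: clinear_on_add [OF g] clinear_on_scaleR [OF g])
    then have "norm (t *\<^sub>R g v) \<le> 2 * real n"
      using v0 norm_triangle_ineq4 [of "g v0 + t *\<^sub>R g v" "g v0"] by simp
    then have "t * norm (g v) \<le> 2 * real n"
      using \<open>0 < t\<close> by simp
    then show ?thesis
      using \<open>0 < s\<close> r by (simp add: t_def s_def [symmetric] field_simps)
  qed (simp add: clinear_on_zero [OF g] clinear_on_zero [OF A])
  then show ?thesis
    by blast
qed

subsection \<open>Boundary values of a selfadjoint restriction\<close>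

text \<open>In the application \<open>A\<close> is the adjoint of \<open>S\<close> with domain
  \<open>D\<close>, and \<open>E\<close> is the domain of \<open>T\<close>. The assumptions
  \<open>symmetric\<close> and \<open>maximal\<close> are the two inclusions between
  \<open>T\<close> and its adjoint.\<close>

locale selfadjoint_boundary_restriction =
  fixes D E :: "'v::chilbert_space set" and A :: "'v \<Rightarrow> 'v"
    and gm :: "'v \<Rightarrow> 'm::complex_inner" and gp :: "'v \<Rightarrow> 'p::complex_inner"
  assumes A: "clinear_on D A" and gm: "clinear_on D gm" and gp: "clinear_on D gp"
    and closed_graph: "closed ((\<lambda>v. (v, A v)) ` D)"
    and green: "u \<in> D \<Longrightarrow> v \<in> D \<Longrightarrow> cinner (A u) v - cinner u (A v)
      = \<i> * (cinner (gm u) (gm v) - cinner (gp u) (gp v))"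
    and boundary_surj: "\<exists>w\<in>D. gm w = y \<and> gp w = x"
    and E: "csubspace E" "E \<subseteq> D"
    and symmetric: "u \<in> E \<Longrightarrow> v \<in> E \<Longrightarrow> cinner (A u) v = cinner u (A v)"
    and maximal: "(\<And>u. u \<in> E \<Longrightarrow> cinner (A u) v = cinner u z) \<Longrightarrow> v \<in> E \<and> A v = z"
begin

lemma E_D: "u \<in> E \<Longrightarrow> u \<in> D"
  using E by blast

lemma D: "csubspace D"
  by (rule clinear_on_subspace [OF A])

lemmas A_simps = clinear_on_add [OF A] clinear_on_diff [OF A] clinear_on_scaleC [OF A]
lemmas D_intros = complex_vector.subspace_add [OF D] complex_vector.subspace_diff [OF D]
  complex_vector.subspace_scale [OF D]
lemmas E_intros = complex_vector.subspace_add [OF E(1)] complex_vector.subspace_diff [OF E(1)]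
  complex_vector.subspace_scale [OF E(1)]

text \<open>Green's identity against some \<open>u\<close> with boundary values
  \<open>gm u = y\<close> and \<open>gp u = 0\<close> expresses \<open>cinner (gm v) y\<close>
  through \<open>v\<close> and \<open>A v\<close>.\<close>

lemma gm_bounded: "\<exists>C. \<forall>v\<in>D. norm (gm v) \<le> C * (norm v + norm (A v))"
proof (rule graph_bounded_of_weakly_continuous [OF A gm closed_graph])
  fix y
  obtain u where u: "u \<in> D" "gm u = y" "gp u = 0"
    using boundary_surj by blast
  have "cinner (gm v) y = cinner (A v) (\<i> *\<^sub>C u) + cinner v (- \<i> *\<^sub>C A u)" if "v \<in> D" for v
    using green [OF that u(1)] u by (simp add: cinner_simps) (simp add: algebra_simps)
  then show "\<exists>a b. \<forall>v\<in>D. cinner (gm v) y = cinner (A v) a + cinner v b"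
    by blast
qed

lemma gp_bounded: "\<exists>C. \<forall>v\<in>D. norm (gp v) \<le> C * (norm v + norm (A v))"
proof (rule graph_bounded_of_weakly_continuous [OF A gp closed_graph])
  fix y
  obtain u where u: "u \<in> D" "gm u = 0" "gp u = y"
    using boundary_surj by blast
  have "cinner (gp v) y = cinner (A v) (- \<i> *\<^sub>C u) + cinner v (\<i> *\<^sub>C A u)" if "v \<in> D" for v
  proof -
    have "cinner v (A u) = cinner (A v) u + \<i> * cinner (gp v) y"
      using green [OF that u(1)] u by (simp add: algebra_simps)
    then show ?thesis
      by (simp add: cinner_simps algebra_simps)
  qed
  then show "\<exists>a b. \<forall>v\<in>D. cinner (gp v) y = cinner (A v) a + cinner v b"
    by blast
qed

section \<open>Isometry of boundary values, closedness and ranges of the restriction\<close>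

lemma norm_boundary_eq: "norm (gm w) = norm (gp w)" if "w \<in> E" for w
  using green [of w w] symmetric [of w w] that E_D
  by (simp add: cinner_self flip: of_real_power)

text \<open>Symmetry passes to the limit, and \<open>maximal\<close> then puts the limit into
  \<open>E\<close>.\<close>

lemma restriction_closed:
  assumes "\<And>n. w n \<in> E" and "w \<longlonglongrightarrow> v" and "(\<lambda>n. A (w n)) \<longlonglongrightarrow> z"
  shows "v \<in> E \<and> A v = z"
proof (rule maximal)
  fix u assume "u \<in> E"
  have "(\<lambda>n. cinner (A u) (w n)) \<longlonglongrightarrow> cinner u z"
    unfolding symmetric [OF \<open>u \<in> E\<close> assms(1)] by (intro tendsto_intros assms)
  moreover have "(\<lambda>n. cinner (A u) (w n)) \<longlonglongrightarrow> cinner (A u) v"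
    by (intro tendsto_intros assms)
  ultimately show "cinner (A u) v = cinner u z"
    by (rule LIMSEQ_unique [symmetric])
qed

text \<open>The cross term vanishes: \<open>cinner (A w) w\<close> is real and \<open>c\<close> is
  purely imaginary.\<close>

lemma norm_shift:
  assumes "w \<in> E" and "c = \<i> \<or> c = - \<i>"
  shows "(norm (A w - c *\<^sub>C w))\<^sup>2 = (norm (A w))\<^sup>2 + (norm w)\<^sup>2"
proof -
  have "Im (cinner (A w) w) = 0"
    using arg_cong [OF cinner_commute [of "A w" w], of Im] symmetric [OF \<open>w \<in> E\<close> \<open>w \<in> E\<close>] by simp
  then show ?thesis
    using assms by (auto simp: norm_diff_power2 cinner_simps norm_scaleC)
qed

text \<open>The classical range criterion for selfadjoint operators. By \<open>norm_shift\<close>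
  the inverse of the shifted operator is a contraction, so the range is complete; its orthogonal
  complement is then shown to be zero.\<close>

lemma shift_surj:
  assumes c: "c = \<i> \<or> c = - \<i>"
  obtains t where "t \<in> E" "A t - c *\<^sub>C t = x"
proof -
  let ?f = "\<lambda>t. A t - c *\<^sub>C t"
  have f: "clinear_on E ?f"
    using clinear_on_subset [OF A E]
    by (simp add: clinear_on_def scaleC_add_right add_diff_add
        complex_vector.scale_right_diff_distrib complex_vector.scale_left_commute [of _ c])
  have "complete (?f ` E)"
  proof (rule completeI)
    fix r assume "\<forall>n. r n \<in> ?f ` E" and "Cauchy r"
    then obtain t where t: "\<And>n. t n \<in> E" "\<And>n. r n = ?f (t n)"
      unfolding image_iff by metis
    have "norm (t m - t n) \<le> 1 * norm (r m - r n)" for m n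
    proof -
      have "r m - r n = ?f (t m - t n)"
        using clinear_on_diff [OF f] t by simp
      then have "(norm (t m - t n))\<^sup>2 \<le> (norm (r m - r n))\<^sup>2"
        using norm_shift [OF _ c, of "t m - t n"] t by (simp add: E_intros)
      then show ?thesis
        using power2_le_imp_le by fastforce
    qed
    then have "Cauchy t"
      by (rule Cauchy_transfer [OF \<open>Cauchy r\<close>])
    then obtain v y where lim: "t \<longlonglongrightarrow> v" "r \<longlonglongrightarrow> y"
      using Cauchy_convergent \<open>Cauchy r\<close> unfolding convergent_def by metis
    have "(\<lambda>n. A (t n)) = (\<lambda>n. r n + c *\<^sub>C t n)"
      using t by auto
    also have "\<dots> \<longlonglongrightarrow> y + c *\<^sub>C v"
      by (intro tendsto_intros lim)
    finally have "v \<in> E \<and> A v = y + c *\<^sub>C v"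
      by (rule restriction_closed [OF t(1) lim(1)])
    then show "\<exists>l\<in>?f ` E. r \<longlonglongrightarrow> l"
      using lim by (intro bexI [of _ y] image_eqI [of _ _ v]) auto
  qed
  then obtain m where m: "m \<in> ?f ` E" "\<And>y. y \<in> ?f ` E \<Longrightarrow> cinner (x - m) y = 0"
    using orthogonal_projection_exists [OF csubspace_image [OF f]] by blast
  define z where "z = x - m"
  have orth: "cinner (A u - c *\<^sub>C u) z = 0" if "u \<in> E" for u
    using m(2) [of "?f u"] that cinner_commute [of "?f u" z] by (simp add: z_def)
  \<comment> \<open>Orthogonality to the range reads
    \<open>cinner (A u) z = cinner u (cnj c *\<^sub>C z)\<close> for all \<open>u\<close> in
    \<open>E\<close>, which is the premise of \<open>maximal\<close>.\<close>
  then have z: "z \<in> E \<and> A z = cnj c *\<^sub>C z"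
    by (intro maximal) (auto simp: cinner_simps)
  have "A z - c *\<^sub>C z = (cnj c - c) *\<^sub>C z"
    using z by (simp add: complex_vector.scale_left_diff_distrib)
  then have "(cnj c - c) * cinner z z = 0"
    using orth [of z] z by (simp only: cinner_scaleC_left)
  moreover have "cnj c \<noteq> c"
    using c by auto
  ultimately have "z = 0"
    using cinner_eq_zero_iff [of z] by simp
  then show ?thesis
    using m that by (auto simp: z_def)
qed

section \<open>The kernel of \<open>A + i\<close> and the domain reduced by it\<close>

definition deficiency_space :: "'v set"
  where "deficiency_space = {k \<in> D. A k = - \<i> *\<^sub>C k}"

text \<open>Modulo the common kernel of \<open>gm\<close> and \<open>gp\<close> this is all of \<open>E\<close>; on it, the graph norm is
  controlled by the boundary values.\<close>

definition reduced_domain :: "'v set"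
  where "reduced_domain = {w \<in> E. A w - \<i> *\<^sub>C w \<in> deficiency_space}"

lemma csubspace_deficiency_space: "csubspace deficiency_space"
  using D by (auto simp: deficiency_space_def complex_vector.subspace_def A_simps
      clinear_on_zero [OF A] scaleC_add_right complex_vector.scale_left_commute)

lemma csubspace_reduced_domain: "csubspace reduced_domain"
  unfolding complex_vector.subspace_def
proof safe
  show "0 \<in> reduced_domain"
    using complex_vector.subspace_0 [OF E(1)] complex_vector.subspace_0 [OF csubspace_deficiency_space]
    by (simp add: reduced_domain_def clinear_on_zero [OF A])
next
  fix x y assume xy: "x \<in> reduced_domain" "y \<in> reduced_domain"
  then have "(A x - \<i> *\<^sub>C x) + (A y - \<i> *\<^sub>C y) \<in> deficiency_space"
    by (intro complex_vector.subspace_add [OF csubspace_deficiency_space])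
      (auto simp: reduced_domain_def)
  then show "x + y \<in> reduced_domain"
    using xy by (simp add: reduced_domain_def E_D A_simps E_intros scaleC_add_right algebra_simps)
next
  fix c x assume x: "x \<in> reduced_domain"
  then have "c *\<^sub>C (A x - \<i> *\<^sub>C x) \<in> deficiency_space"
    by (intro complex_vector.subspace_scale [OF csubspace_deficiency_space])
      (auto simp: reduced_domain_def)
  then show "c *\<^sub>C x \<in> reduced_domain"
    using x by (simp add: reduced_domain_def E_D A_simps E_intros
        complex_vector.scale_right_diff_distrib mult.commute)
qed

text \<open>A limit of graph points \<open>(k, - i k)\<close> has the same form and stays in the
  closed graph of \<open>A\<close>.\<close>

lemma complete_deficiency_space: "complete deficiency_space"
  unfolding complete_eq_closed closed_sequential_limits
proof (intro allI impI)
  fix k l assume k: "(\<forall>n. k n \<in> deficiency_space) \<and> k \<longlonglongrightarrow> l"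
  then have "(\<lambda>n. (k n, - \<i> *\<^sub>C k n)) \<longlonglongrightarrow> (l, - \<i> *\<^sub>C l)"
    by (intro tendsto_intros) auto
  moreover have "(k n, - \<i> *\<^sub>C k n) \<in> (\<lambda>v. (v, A v)) ` D" for n
    using k by (force simp: deficiency_space_def)
  ultimately have "(l, - \<i> *\<^sub>C l) \<in> (\<lambda>v. (v, A v)) ` D"
    by (rule closed_sequentially [OF closed_graph, rotated])
  then show "l \<in> deficiency_space"
    by (auto simp: deficiency_space_def)
qed

text \<open>Turns the left side of Green's identity at \<open>k\<close> into a pairing with
  \<open>A w - i w\<close>, used both for orthogonality and for the norm estimate.\<close>

lemma deficiency_green:
  assumes "k \<in> deficiency_space"
  shows "cinner (A k) w - cinner k (A w) = - cinner k (A w - \<i> *\<^sub>C w)"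
  using assms by (simp add: deficiency_space_def cinner_simps del: complex_vector.scale_minus_left)

text \<open>Since \<open>A + i\<close> already maps \<open>E\<close> onto the whole space, any
  \<open>v\<close> differs from an element of \<open>E\<close> by an element of the kernel of
  \<open>A + i\<close>.\<close>

lemma domain_decomposition:
  assumes "v \<in> D"
  obtains t k where "t \<in> E" "k \<in> deficiency_space" "v = t + k"
proof -
  obtain t where t: "t \<in> E" "A t - (- \<i>) *\<^sub>C t = A v - (- \<i>) *\<^sub>C v"
    using shift_surj by blast
  then have "A (v - t) = - \<i> *\<^sub>C (v - t)"
    using assms by (simp add: A_simps E_D scaleC_add_right complex_vector.scale_right_diff_distrib algebra_simps)
  then have "v - t \<in> deficiency_space"
    using t assms by (simp add: deficiency_space_def E_D D_intros)
  then show ?thesis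
    using that t by (metis add.commute diff_add_cancel)
qed

text \<open>Joint surjectivity supplies \<open>v\<close> with boundary values
  \<open>(gm d, 0)\<close> or \<open>(0, gp d)\<close>, and Green's identity then gives the squared
  norm.\<close>

lemma boundary_eq_0:
  assumes "d \<in> D" and "\<And>v. v \<in> D \<Longrightarrow> cinner (A v) d = cinner v (A d)"
  shows "gm d = 0" "gp d = 0"
proof -
  obtain v where "v \<in> D" "gm v = gm d" "gp v = 0"
    using boundary_surj by blast
  with green [of v d] assms show "gm d = 0"
    using cinner_eq_zero_iff [of "gm d"] by simp
  obtain v where "v \<in> D" "gm v = 0" "gp v = gp d"
    using boundary_surj by blast
  with green [of v d] assms show "gp d = 0"
    using cinner_eq_zero_iff [of "gp d"] by simp
qed

text \<open>Replace \<open>A w - i w\<close> by its projection \<open>k\<close> onto the deficiency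
  space and solve \<open>A w' - i w' = k\<close>. The change \<open>w - w'\<close> has zero boundary
  values.\<close>

lemma reduced_representative:
  assumes w: "w \<in> E"
  obtains w' where "w' \<in> reduced_domain" "gm w' = gm w" "gp w' = gp w"
proof -
  obtain k where k: "k \<in> deficiency_space"
    and orth: "\<And>z. z \<in> deficiency_space \<Longrightarrow> cinner (A w - \<i> *\<^sub>C w - k) z = 0"
    using orthogonal_projection_exists [OF csubspace_deficiency_space complete_deficiency_space] by blast
  obtain w' where w': "w' \<in> E" "A w' - \<i> *\<^sub>C w' = k"
    using shift_surj by blast
  define d where "d = w - w'"
  have d: "d \<in> E"
    using w w' by (simp add: d_def E_intros)
  have "A d - \<i> *\<^sub>C d = A w - \<i> *\<^sub>C w - k"
    using w w' by (simp add: d_def A_simps E_D complex_vector.scale_right_diff_distrib algebra_simps)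
  then have orth': "cinner z (A d - \<i> *\<^sub>C d) = 0" if "z \<in> deficiency_space" for z
    using orth [OF that] by (subst cinner_commute) simp
  \<comment> \<open>Split \<open>v\<close> into a part in \<open>E\<close>, treated by symmetry, and
    a part in the deficiency space, treated by \<open>orth'\<close>.\<close>
  have "cinner (A v) d = cinner v (A d)" if v: "v \<in> D" for v
  proof -
    obtain t l where tl: "t \<in> E" "l \<in> deficiency_space" "v = t + l"
      using domain_decomposition [OF v] by blast
    moreover have "cinner (A l) d = cinner l (A d)"
      using deficiency_green [OF tl(2), of d] orth' [OF tl(2)] by simp
    moreover have "l \<in> D"
      using tl by (simp add: deficiency_space_def)
    ultimately show ?thesis
      using symmetric [OF tl(1) d] by (simp add: A_simps E_D cinner_simps)
  qed
  then have "gm d = 0" "gp d = 0"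
    using boundary_eq_0 E_D [OF d] by blast+
  then show ?thesis
    using that [of w'] w w' k
    by (simp add: d_def reduced_domain_def E_D clinear_on_diff [OF gm] clinear_on_diff [OF gp])
qed

text \<open>A converse to \<open>gm_bounded\<close>: for \<open>k = A w - i w\<close> the graph norm
  is twice \<open>norm k\<close>, so Green's identity for \<open>k\<close> and \<open>w\<close>
  bounds \<open>norm k\<close>, and with it \<open>w\<close> and \<open>A w\<close>, by
  \<open>gm w\<close>.\<close>

lemma reduced_domain_bounded:
  "\<exists>C. \<forall>w\<in>reduced_domain. norm w \<le> C * norm (gm w) \<and> norm (A w) \<le> C * norm (gm w)"
proof -
  obtain C C' where C: "\<And>v. v \<in> D \<Longrightarrow> norm (gm v) \<le> C * (norm v + norm (A v))"
      "\<And>v. v \<in> D \<Longrightarrow> norm (gp v) \<le> C' * (norm v + norm (A v))"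
    using gm_bounded gp_bounded by blast
  have "norm w \<le> (2 * C + 2 * C') * norm (gm w) \<and> norm (A w) \<le> (2 * C + 2 * C') * norm (gm w)"
    if w: "w \<in> reduced_domain" for w
  proof -
    define k where "k = A w - \<i> *\<^sub>C w"
    have k: "k \<in> deficiency_space" "k \<in> D" "norm (A k) = norm k" and wE: "w \<in> E"
      using w by (auto simp: reduced_domain_def k_def deficiency_space_def norm_scaleC)
    have kk: "cinner k k = - (\<i> * (cinner (gm k) (gm w) - cinner (gp k) (gp w)))"
      using deficiency_green [OF k(1), of w] green [OF k(2) E_D [OF wE]]
      unfolding k_def [symmetric] by (metis add.inverse_inverse)
    have "norm k * norm k = cmod (cinner k k)"
      by (simp add: cinner_self norm_power power2_eq_square norm_mult)
    also have "\<dots> = cmod (cinner (gm k) (gm w) - cinner (gp k) (gp w))"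
      unfolding kk by (simp add: norm_mult)
    also have "\<dots> \<le> norm (gm k) * norm (gm w) + norm (gp k) * norm (gp w)"
      by (rule order_trans [OF norm_triangle_ineq4]) (intro add_mono cinner_norm_le)
    also have "\<dots> = (norm (gm k) + norm (gp k)) * norm (gm w)"
      using norm_boundary_eq [OF wE] by (simp add: distrib_right)
    also have "\<dots> \<le> ((2 * C + 2 * C') * norm k) * norm (gm w)"
      using C [OF k(2)] k(3) by (intro mult_right_mono) (simp_all add: algebra_simps)
    finally have "norm k * norm k \<le> ((2 * C + 2 * C') * norm (gm w)) * norm k"
      by (simp only: mult_ac)
    then have le: "norm k \<le> (2 * C + 2 * C') * norm (gm w)" if "norm k \<noteq> 0"
      using that by simp
    have norms: "(norm (A w))\<^sup>2 + (norm w)\<^sup>2 = (norm k)\<^sup>2"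
      using norm_shift [OF wE, of \<i>] by (simp add: k_def)
    show ?thesis
    proof (cases "norm k = 0")
      case True
      then have "w = 0"
        using norms by (simp add: sum_power2_eq_zero_iff)
      then show ?thesis
        using clinear_on_zero [OF A] clinear_on_zero [OF gm] by simp
    next
      case False
      have "norm w \<le> norm k" "norm (A w) \<le> norm k"
        by (rule power2_le_imp_le; use norms in \<open>simp flip: norms\<close>)+
      then show ?thesis
        using le [OF False] by linarith
    qed
  qed
  then show ?thesis
    by blast
qed

text \<open>The bound on the reduced domain lifts Cauchy boundary values to a sequence converging in
  the graph norm; the limit lies in \<open>E\<close> by closedness, and boundedness of
  \<open>gm\<close> and \<open>gp\<close> carries the convergence back.\<close>

lemma boundary_values_converge:
  assumes w: "\<And>n. w n \<in> reduced_domain" and Cauchy: "Cauchy (\<lambda>n. gm (w n))"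
  obtains v where "v \<in> E" "(\<lambda>n. gm (w n)) \<longlonglongrightarrow> gm v" "(\<lambda>n. gp (w n)) \<longlonglongrightarrow> gp v"
proof -
  obtain C where C: "\<And>w. w \<in> reduced_domain \<Longrightarrow> norm w \<le> C * norm (gm w)"
      "\<And>w. w \<in> reduced_domain \<Longrightarrow> norm (A w) \<le> C * norm (gm w)"
    using reduced_domain_bounded by blast
  have wE: "w n \<in> E" for n
    using w [of n] by (simp add: reduced_domain_def)
  have diff: "w m - w n \<in> reduced_domain" for m n
    by (intro complex_vector.subspace_diff [OF csubspace_reduced_domain] w)
  have "Cauchy w" "Cauchy (\<lambda>n. A (w n))"
    using C [OF diff] wE
    by (auto intro!: Cauchy_transfer [OF Cauchy, of _ C]
        simp: clinear_on_diff [OF gm] clinear_on_diff [OF A] E_D)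
  then obtain v z where lim: "w \<longlonglongrightarrow> v" "(\<lambda>n. A (w n)) \<longlonglongrightarrow> z"
    using Cauchy_convergent unfolding convergent_def by metis
  then have v: "v \<in> E" "A v = z"
    using restriction_closed [of w v z] wE by blast+
  \<comment> \<open>Stated for an arbitrary codomain, to be used for both \<open>gm\<close> and
    \<open>gp\<close>.\<close>
  have "(\<lambda>n. g (w n)) \<longlonglongrightarrow> g v"
    if g: "clinear_on D g" and B: "\<forall>v\<in>D. norm (g v) \<le> B * (norm v + norm (A v))"
    for g :: "'v \<Rightarrow> 'c::complex_inner" and B
  proof (subst LIM_zero_iff [symmetric], rule tendsto_norm_zero_cancel, rule tendsto_sandwich)
    show "\<forall>\<^sub>F n in sequentially. 0 \<le> norm (g (w n) - g v)"
      by simp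
    show "\<forall>\<^sub>F n in sequentially. norm (g (w n) - g v) \<le> B * (norm (w n - v) + norm (A (w n) - z))"
      using B v wE by (intro always_eventually allI)
        (metis A_simps(2) D_intros(2) E_D clinear_on_diff [OF g])
    have "(\<lambda>n. B * (norm (w n - v) + norm (A (w n) - z))) \<longlonglongrightarrow> B * (norm (v - v) + norm (z - z))"
      by (intro tendsto_intros lim)
    then show "(\<lambda>n. B * (norm (w n - v) + norm (A (w n) - z))) \<longlonglongrightarrow> 0"
      by simp
  qed simp
  then show ?thesis
    using that v gm gp gm_bounded gp_bounded by metis
qed

section \<open>Completeness of the boundary values and surjectivity on \<open>E\<close>\<close>

lemma complete_gm: "complete (gm ` E)"
proof (rule completeI)
  fix f assume "\<forall>n. f n \<in> gm ` E" and "Cauchy f"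
  then have "\<forall>n. \<exists>w. w \<in> reduced_domain \<and> f n = gm w"
    using reduced_representative by (metis imageE)
  then obtain w where w: "\<And>n. w n \<in> reduced_domain" "\<And>n. f n = gm (w n)"
    by metis
  moreover have "f = (\<lambda>n. gm (w n))"
    using w by auto
  ultimately show "\<exists>l\<in>gm ` E. f \<longlonglongrightarrow> l"
    using boundary_values_converge \<open>Cauchy f\<close> by (metis imageI)
qed

lemma complete_gp: "complete (gp ` E)"
proof (rule completeI)
  fix f assume "\<forall>n. f n \<in> gp ` E" and "Cauchy f"
  then have "\<forall>n. \<exists>w. w \<in> reduced_domain \<and> f n = gp w"
    using reduced_representative by (metis imageE)
  then obtain w where w: "\<And>n. w n \<in> reduced_domain" "\<And>n. f n = gp (w n)"
    by metis
  then have wE: "w n \<in> E" for n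
    by (simp add: reduced_domain_def)
  have f: "f = (\<lambda>n. gp (w n))"
    using w by auto
  \<comment> \<open>The isometry between \<open>gp\<close> and \<open>gm\<close> on \<open>E\<close>
    reduces the claim to Cauchy values of \<open>gm\<close>.\<close>
  have "norm (gm (w m) - gm (w n)) = norm (f m - f n)" for m n
    using norm_boundary_eq [of "w m - w n"] wE
    by (simp add: w E_intros E_D clinear_on_diff [OF gm] clinear_on_diff [OF gp])
  then have "Cauchy (\<lambda>n. gm (w n))"
    by (intro Cauchy_transfer [OF \<open>Cauchy f\<close>, of _ 1]) simp
  then show "\<exists>l\<in>gp ` E. f \<longlonglongrightarrow> l"
    using boundary_values_converge w unfolding f by (metis imageI)
qed

lemma gm_surj: "gm ` E = UNIV"
proof (intro equalityI subset_UNIV subsetI)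
  fix y
  have "csubspace (gm ` E)"
    by (rule csubspace_image [OF clinear_on_subset [OF gm E]])
  then obtain m where m: "m \<in> gm ` E" "\<And>z. z \<in> gm ` E \<Longrightarrow> cinner (y - m) z = 0"
    using orthogonal_projection_exists complete_gm by blast
  obtain v where v: "v \<in> D" "gm v = y - m" "gp v = 0"
    using boundary_surj by blast
  have "v \<in> E \<and> A v = A v"
  proof (rule maximal)
    fix u assume u: "u \<in> E"
    then have "cinner (gm u) (gm v) = 0"
      using m(2) [of "gm u"] v by (subst cinner_commute) simp
    then show "cinner (A u) v = cinner u (A v)"
      using green [OF E_D [OF u] v(1)] v by simp
  qed
  then have "y = m"
    using norm_boundary_eq [of v] v by simp
  then show "y \<in> gm ` E"
    using m by simp
qed

lemma gp_surj: "gp ` E = UNIV"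
proof (intro equalityI subset_UNIV subsetI)
  fix y
  have "csubspace (gp ` E)"
    by (rule csubspace_image [OF clinear_on_subset [OF gp E]])
  then obtain m where m: "m \<in> gp ` E" "\<And>z. z \<in> gp ` E \<Longrightarrow> cinner (y - m) z = 0"
    using orthogonal_projection_exists complete_gp by blast
  obtain v where v: "v \<in> D" "gm v = 0" "gp v = y - m"
    using boundary_surj by blast
  have "v \<in> E \<and> A v = A v"
  proof (rule maximal)
    fix u assume u: "u \<in> E"
    then have "cinner (gp u) (gp v) = 0"
      using m(2) [of "gp u"] v by (subst cinner_commute) simp
    then show "cinner (A u) v = cinner u (A v)"
      using green [OF E_D [OF u] v(1)] v by simp
  qed
  then have "y = m"
    using norm_boundary_eq [of v] v by simp
  then show "y \<in> gp ` E"
    using m by simp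
qed

text \<open>On \<open>E\<close>, \<open>gp w\<close> determines \<open>gm w\<close> by
  \<open>norm_boundary_eq\<close> applied to differences, so any right inverse \<open>s\<close> of
  \<open>gp\<close> defines the same \<Phi>.\<close>

lemma unitary_coupling: "\<exists>\<Phi>. unitary \<Phi> \<and> E = {w \<in> D. \<Phi> (gp w) = gm w}"
proof -
  have "\<exists>w. w \<in> E \<and> gp w = x" for x
    using gp_surj by (metis UNIV_I imageE)
  then obtain s where s: "\<And>x. s x \<in> E" "\<And>x. gp (s x) = x"
    by metis
  define \<Phi> where "\<Phi> x = gm (s x)" for x
  have \<Phi>: "\<Phi> (gp w) = gm w" if "w \<in> E" for w
    using norm_boundary_eq [of "s (gp w) - w"] s [of "gp w"] that
    by (simp add: \<Phi>_def E_intros E_D clinear_on_diff [OF gm] clinear_on_diff [OF gp])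
  have "unitary \<Phi>"
    unfolding unitary_def Vector_Spaces.linear_iff
  proof (intro conjI allI)
    show "\<Phi> (x + y) = \<Phi> x + \<Phi> y" for x y
      using \<Phi> [of "s x + s y"] s
      by (simp add: \<Phi>_def E_intros E_D clinear_on_add [OF gm] clinear_on_add [OF gp])
    show "\<Phi> (c *\<^sub>C x) = c *\<^sub>C \<Phi> x" for c x
      using \<Phi> [of "c *\<^sub>C s x"] s
      by (simp add: \<Phi>_def E_intros E_D clinear_on_scaleC [OF gm] clinear_on_scaleC [OF gp])
    show "surj \<Phi>"
      using gm_surj \<Phi> by (metis surjI UNIV_I imageE surj_def)
    show "norm (\<Phi> x) = norm x" for x
      using norm_boundary_eq [OF s(1)] s by (simp add: \<Phi>_def)
  qed (rule complex_vector.vector_space_axioms)+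
  \<comment> \<open>Such a \<open>w\<close> shares its boundary values with an element of
    \<open>E\<close>, so Green's identity against \<open>E\<close> gives the premise of
    \<open>maximal\<close>.\<close>
  moreover have "w \<in> E" if w: "w \<in> D" "\<Phi> (gp w) = gm w" for w
  proof -
    let ?t = "s (gp w)"
    have t: "?t \<in> E" "gp ?t = gp w" "gm ?t = gm w"
      using s w by (auto simp: \<Phi>_def)
    have "w \<in> E \<and> A w = A w"
    proof (rule maximal)
      fix u assume u: "u \<in> E"
      show "cinner (A u) w = cinner u (A w)"
        using green [OF E_D [OF u] w(1)] green [OF E_D [OF u] E_D [OF t(1)]] symmetric [OF u t(1)] t
        by simp
    qed
    then show ?thesis
      by blast
  qed
  ultimately show ?thesis
    using \<Phi> E_D by blast
qed

end

subsection \<open>Adjoints and boundary quadruples\<close>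

lemma cinner_dense_eq:
  fixes x y :: "'a::complex_inner"
  assumes "closure X = UNIV" and "\<And>u. u \<in> X \<Longrightarrow> cinner u x = cinner u y"
  shows "x = y"
proof -
  have "closed {u. cinner u x = cinner u y}"
    by (intro closed_Collect_eq continuous_intros)
  then have "closure X \<subseteq> {u. cinner u x = cinner u y}"
    using assms(2) by (intro closure_minimal) auto
  then have "cinner (x - y) x = cinner (x - y) y"
    using assms(1) by auto
  then have "cinner (x - y) (x - y) = 0"
    by (simp add: cinner_diff_right)
  then show ?thesis
    using cinner_eq_zero_iff [of "x - y"] by simp
qed

text \<open>Density makes the representing vector unique, which eliminates the description operator
  in \<open>op_adjoint\<close>.\<close>

lemma op_adjoint_eq_Some_iff:
  assumes "densely_defined T"
  shows "op_adjoint T v = Some w \<longleftrightarrow> (\<forall>u\<in>dom T. cinner (the (T u)) v = cinner u w)"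
proof -
  have unique: "w1 = w2"
    if "\<forall>u\<in>dom T. cinner (the (T u)) v = cinner u w1" "\<forall>u\<in>dom T. cinner (the (T u)) v = cinner u w2"
    for w1 w2
    using assms that by (intro cinner_dense_eq [of "dom T"]) (auto simp: densely_defined_def)
  show ?thesis
  proof (cases "\<exists>w. \<forall>u\<in>dom T. cinner (the (T u)) v = cinner u w")
    case True
    then obtain w1 where w1: "\<forall>u\<in>dom T. cinner (the (T u)) v = cinner u w1"
      by blast
    then have "(THE w. \<forall>u\<in>dom T. cinner (the (T u)) v = cinner u w) = w1"
      using unique by (intro the_equality) blast+
    then have "op_adjoint T v = Some w1"
      using True by (simp add: op_adjoint_def)
    then show ?thesis
      using w1 unique by (metis option.inject)
  next
    case False
    then have "op_adjoint T v = None"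
      unfolding op_adjoint_def by (rule if_not_P)
    then show ?thesis
      using False by (metis option.distinct(1))
  qed
qed

lemma op_adjoint_eqD:
  assumes "densely_defined T" and "v \<in> dom (op_adjoint T)" and "u \<in> dom T"
  shows "cinner (the (T u)) v = cinner u (the (op_adjoint T v))"
proof -
  obtain w where "op_adjoint T v = Some w"
    using assms(2) by blast
  then show ?thesis
    using assms(3) op_adjoint_eq_Some_iff [OF assms(1), of v w] by (metis option.sel)
qed

lemma clinear_on_op_adjoint:
  assumes "densely_defined T"
  shows "clinear_on (dom (op_adjoint T)) (\<lambda>v. the (op_adjoint T v))"
proof -
  note eq = op_adjoint_eqD [OF assms]
  have zero: "op_adjoint T 0 = Some 0"
    by (simp add: op_adjoint_eq_Some_iff [OF assms])
  have add: "op_adjoint T (x + y) = Some (the (op_adjoint T x) + the (op_adjoint T y))"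
    if "x \<in> dom (op_adjoint T)" "y \<in> dom (op_adjoint T)" for x y
    using eq that by (simp add: op_adjoint_eq_Some_iff [OF assms] cinner_add_right)
  have scale: "op_adjoint T (a *\<^sub>C x) = Some (a *\<^sub>C the (op_adjoint T x))"
    if "x \<in> dom (op_adjoint T)" for a x
    using eq that by (simp add: op_adjoint_eq_Some_iff [OF assms] cinner_scaleC_right)
  show ?thesis
    unfolding clinear_on_def complex_vector.subspace_def
    by (intro conjI ballI allI) (simp_all add: zero add scale domIff)
qed

text \<open>Each test vector \<open>u\<close> imposes one continuous equation on the graph, which is
  the intersection of their solution sets.\<close>

lemma closed_graph_op_adjoint:
  assumes "densely_defined T"
  shows "closed ((\<lambda>v. (v, the (op_adjoint T v))) ` dom (op_adjoint T))"
proof -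
  have "(\<lambda>v. (v, the (op_adjoint T v))) ` dom (op_adjoint T)
      = {p. op_adjoint T (fst p) = Some (snd p)}"
    by (auto simp: image_iff)
  also have "\<dots> = (\<Inter>u\<in>dom T. {p. cinner (the (T u)) (fst p) = cinner u (snd p)})"
    by (auto simp: op_adjoint_eq_Some_iff [OF assms])
  also have "closed \<dots>"
    by (intro closed_INT ballI closed_Collect_eq continuous_intros)
  finally show ?thesis .
qed

lemma densely_defined_mono:
  assumes "densely_defined S" and "S \<subseteq>\<^sub>m T"
  shows "densely_defined T"
  using closure_mono [OF map_le_implies_dom_le [OF assms(2)]] assms(1)
  unfolding densely_defined_def by blast

lemma op_adjoint_antimono:
  assumes "densely_defined S" and "S \<subseteq>\<^sub>m T"
  shows "op_adjoint T \<subseteq>\<^sub>m op_adjoint S"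
proof -
  have T: "densely_defined T"
    by (rule densely_defined_mono [OF assms])
  have S: "the (S u) = the (T u)" "u \<in> dom T" if "u \<in> dom S" for u
  proof -
    have "S u = T u"
      using assms(2) that by (simp add: map_le_def)
    then show "the (S u) = the (T u)" "u \<in> dom T"
      using that by (simp_all add: domIff)
  qed
  have "op_adjoint S v = Some w" if "op_adjoint T v = Some w" for v w
    using that S unfolding op_adjoint_eq_Some_iff [OF T] op_adjoint_eq_Some_iff [OF assms(1)] by simp
  then show ?thesis
    by (auto simp: map_le_def)
qed

text \<open>Polarization: norms of sums give the real part, and replacing \<open>y\<close> by
  \<open>i y\<close> gives the imaginary part.\<close>

lemma unitary_cinner:
  assumes "unitary U"
  shows "cinner (U x) (U y) = cinner x y"
proof -
  have U: "U (x + y) = U x + U y" "U (a *\<^sub>C x) = a *\<^sub>C U x" "norm (U x) = norm x" for x y a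
    using assms unfolding unitary_def Vector_Spaces.linear_iff by auto
  have Re: "Re (cinner (U x) (U y)) = Re (cinner x y)" for x y
    using norm_add_power2 [of "U x" "U y"] norm_add_power2 [of x y] by (simp add: U flip: U(1))
  show ?thesis
    using Re [of x y] Re [of x "\<i> *\<^sub>C y"] by (simp add: U cinner_scaleC_right complex_eq_iff)
qed

text \<open>Where the kernel sum condition enters: a preimage of \<open>y\<close> is reduced to its
  part in the kernel of \<open>Gp\<close>, a preimage of \<open>x\<close> to its part in the kernel
  of \<open>Gm\<close>, and the two parts are added.\<close>

lemma boundary_quadruple_surj:
  assumes "boundary_quadruple S Gm Gp"
  shows "\<exists>w\<in>dom (op_adjoint S). the (Gm w) = y \<and> the (Gp w) = x"
proof -
  let ?D = "dom (op_adjoint S)"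
  note bq = assms [unfolded boundary_quadruple_def linear_operator_iff_clinear_on]
  have gm: "clinear_on ?D (\<lambda>w. the (Gm w))" and gp: "clinear_on ?D (\<lambda>w. the (Gp w))"
    using bq by auto
  have split: "\<exists>a b. v = a + b \<and> a \<in> op_ker Gp \<and> b \<in> op_ker Gm" if "v \<in> ?D" for v
    using bq that by blast
  have ker: "a \<in> ?D \<and> the (Gp a) = 0" if "a \<in> op_ker Gp" for a
    using bq that by (auto simp: op_ker_def)
  have ker': "b \<in> ?D \<and> the (Gm b) = 0" if "b \<in> op_ker Gm" for b
    using bq that by (auto simp: op_ker_def)
  have "y \<in> ran Gm" "x \<in> ran Gp"
    using bq by auto
  then obtain u v where "Gm u = Some y" "Gp v = Some x"
    by (auto simp: ran_def)
  then have u: "u \<in> ?D" "the (Gm u) = y" and v: "v \<in> ?D" "the (Gp v) = x"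
    using bq by (auto simp: set_eq_iff domIff)
  obtain a b where ab: "u = a + b" "a \<in> op_ker Gp" "b \<in> op_ker Gm"
    using split [OF u(1)] by blast
  obtain a' b' where ab': "v = a' + b'" "a' \<in> op_ker Gp" "b' \<in> op_ker Gm"
    using split [OF v(1)] by blast
  have "the (Gm a) = y" "the (Gp b') = x"
    using u(2) v(2) ker ker' ab ab' by (auto simp: clinear_on_add [OF gm] clinear_on_add [OF gp])
  then have "the (Gm (a + b')) = y \<and> the (Gp (a + b')) = x"
    using ker ker' ab ab' by (simp add: clinear_on_add [OF gm] clinear_on_add [OF gp])
  then show ?thesis
    using ker ker' ab ab' complex_vector.subspace_add [OF clinear_on_subspace [OF gm]] by blast
qed

theorem theorem5p5:
  fixes S T :: "'v::chilbert_space \<rightharpoonup> 'v"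
    and Gm :: "'v \<rightharpoonup> 'm::complex_inner"
    and Gp :: "'v \<rightharpoonup> 'p::complex_inner"
  assumes "linear_operator S" and "densely_defined S" and "symmetric_operator S"
    and "boundary_quadruple S Gm Gp"
    and "\<exists>U :: 'p \<Rightarrow> 'm. unitary U"
    and "linear_operator T" and "S \<subseteq>\<^sub>m T"
  shows "selfadjoint_operator T \<longleftrightarrow>
    (\<exists>\<Phi> :: 'p \<Rightarrow> 'm. unitary \<Phi> \<and>
      dom T = {w \<in> dom (op_adjoint S). \<Phi> (the (Gp w)) = the (Gm w)} \<and>
      (\<forall>w\<in>dom T. the (T w) = the (op_adjoint S w)))"
proof -
  let ?D = "dom (op_adjoint S)" and ?A = "\<lambda>v. the (op_adjoint S v)"
    and ?gm = "\<lambda>v. the (Gm v)" and ?gp = "\<lambda>v. the (Gp v)"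
  note bq = assms(4) [unfolded boundary_quadruple_def linear_operator_iff_clinear_on]
  note surj = boundary_quadruple_surj [OF assms(4)]
  have green: "cinner (?A u) v - cinner u (?A v)
      = \<i> * (cinner (?gm u) (?gm v) - cinner (?gp u) (?gp v))" if "u \<in> ?D" "v \<in> ?D" for u v
    using bq that by blast
  have T: "densely_defined T"
    by (rule densely_defined_mono [OF assms(2,7)])
  note antimono = op_adjoint_antimono [OF assms(2,7)]
  show ?thesis
  proof
    assume "selfadjoint_operator T"
    then have self: "op_adjoint T = T"
      by (simp add: selfadjoint_operator_def)
    \<comment> \<open>From \<open>S \<subseteq>\<^sub>m T\<close> the adjoint of \<open>T\<close>,
      which is \<open>T\<close> itself, is contained in the adjoint of \<open>S\<close>.\<close>
    have TS: "u \<in> ?D" "?A u = the (T u)" if "u \<in> dom T" for u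
      using antimono that unfolding self by (auto simp: map_le_def) (metis domI option.sel)+
    interpret selfadjoint_boundary_restriction ?D "dom T" ?A ?gm ?gp
    proof
      show "clinear_on ?D ?gm" "clinear_on ?D ?gp"
        using bq by auto
      show "csubspace (dom T)"
        using assms(6) by (simp add: linear_operator_def)
      show "cinner (?A u) v = cinner u (?A v)" if "u \<in> dom T" "v \<in> dom T" for u v
        using op_adjoint_eqD [OF T, of v u] that by (simp add: self TS)
      show "v \<in> dom T \<and> ?A v = z" if "\<And>u. u \<in> dom T \<Longrightarrow> cinner (?A u) v = cinner u z" for v z
      proof -
        have "op_adjoint T v = Some z"
          using that by (simp add: op_adjoint_eq_Some_iff [OF T] TS)
        then show ?thesis
          using TS [of v] by (auto simp: self)
      qed
      show "clinear_on ?D ?A" "closed ((\<lambda>v. (v, ?A v)) ` ?D)"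
        by (rule clinear_on_op_adjoint [OF assms(2)] closed_graph_op_adjoint [OF assms(2)])+
      show "cinner (?A u) v - cinner u (?A v) = \<i> * (cinner (?gm u) (?gm v) - cinner (?gp u) (?gp v))"
        if "u \<in> ?D" "v \<in> ?D" for u v
        by (rule green [OF that])
      show "\<exists>w\<in>?D. ?gm w = y \<and> ?gp w = x" for x y
        by (rule surj)
      show "dom T \<subseteq> ?D"
        using TS(1) by (rule subsetI)
    qed
    show "\<exists>\<Phi> :: 'p \<Rightarrow> 'm. unitary \<Phi> \<and> dom T = {w \<in> ?D. \<Phi> (?gp w) = ?gm w} \<and>
        (\<forall>w\<in>dom T. the (T w) = ?A w)"
      using unitary_coupling TS by auto
  next
    assume "\<exists>\<Phi> :: 'p \<Rightarrow> 'm. unitary \<Phi> \<and> dom T = {w \<in> ?D. \<Phi> (?gp w) = ?gm w} \<and>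
        (\<forall>w\<in>dom T. the (T w) = ?A w)"
    then obtain \<Phi> :: "'p \<Rightarrow> 'm" where \<Phi>: "unitary \<Phi>"
      and dom: "dom T = {w \<in> ?D. \<Phi> (?gp w) = ?gm w}"
      and val: "\<And>w. w \<in> dom T \<Longrightarrow> the (T w) = ?A w"
      by blast
    \<comment> \<open>\<open>T\<close> is contained in its adjoint: for \<open>u\<close> and
      \<open>v\<close> in \<open>dom T\<close> the right side of Green's identity vanishes since
      \<Phi> preserves inner products.\<close>
    have 1: "op_adjoint T v = Some z" if "T v = Some z" for v z
    proof -
      have v: "v \<in> dom T" "?A v = z"
        using that val [of v] by auto
      have "cinner (the (T u)) v = cinner u z" if u: "u \<in> dom T" for u
      proof -
        have "cinner (?gm u) (?gm v) = cinner (?gp u) (?gp v)"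
          using unitary_cinner [OF \<Phi>, of "?gp u" "?gp v"] u v dom by simp
        then show ?thesis
          using green [of u v] u v dom val by simp
      qed
      then show ?thesis
        by (simp add: op_adjoint_eq_Some_iff [OF T])
    qed
    have 2: "T v = Some z" if adj: "op_adjoint T v = Some z" for v z
    proof -
      have v: "op_adjoint S v = Some z"
        using antimono adj by (auto simp: map_le_def) (metis domI)
      then have vD: "v \<in> ?D"
        by blast
      \<comment> \<open>The defect of \<open>v\<close> in the boundary condition. The test vector
        \<open>u\<close> gets boundary values \<open>r\<close> and the preimage of \<open>r\<close>
        under \<Phi>, so it lies in \<open>dom T\<close> and Green's identity yields
        \<open>cinner r r = 0\<close>.\<close>
      define r where "r = ?gm v - \<Phi> (?gp v)"
      obtain x where x: "\<Phi> x = r"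
        using \<Phi> unfolding unitary_def by (metis surj_def)
      obtain u where u: "u \<in> ?D" "?gm u = r" "?gp u = x"
        using surj by blast
      then have uT: "u \<in> dom T"
        using x by (simp add: dom)
      have "cinner (the (T u)) v = cinner u z"
        using adj uT op_adjoint_eq_Some_iff [OF T] by blast
      then have "cinner (?A u) v = cinner u (?A v)"
        by (simp add: v val [OF uT])
      then have "cinner r (?gm v) = cinner x (?gp v)"
        using green [OF u(1) vD] u by simp
      then have "cinner r r = 0"
        using unitary_cinner [OF \<Phi>, of x "?gp v"] x by (simp add: r_def cinner_diff_right)
      then have "\<Phi> (?gp v) = ?gm v"
        using cinner_eq_zero_iff [of r] by (simp add: r_def)
      then have "v \<in> dom T"
        using vD by (simp add: dom)
      then show ?thesis
        using val [of v] v by auto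
    qed
    have "T v = op_adjoint T v" for v
      using 1 [of v] 2 [of v] by (cases "T v"; cases "op_adjoint T v") auto
    then have "T = op_adjoint T"
      by (rule ext)
    then show "selfadjoint_operator T"
      using T by (simp add: selfadjoint_operator_def)
  qed
qed

end
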